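(* Let $X$ be an interval space and $a,b\in X$. If the binary relation $\langle[a,b],\cdot,\cdot\rangle$ on $X$ is transitive, then for every $c\in X$, $[\{a\},[b,c]]\subseteq[[a,b],\{c\}]$.
   Context: An interval space is a set $X$ with a ternary relation $\langle\cdot,\cdot,\cdot\rangle$ such that: $\langle x,x,a\rangle$ and $\langle a,x,x\rangle$ for all $a,x\in X$; $\langle x,a,z\rangle\Rightarrow\langle z,a,x\rangle$; and $\langle x,y,x\rangle$ implies $y=x$. For $A\subseteq X$ and $b,c\in X$, $\langle A,b,c\rangle$ means there is $a\in A$ with $\langle a,b,c\rangle$. For $a,c\in X$, $[a,c]=\{x\in X:\langle a,x,c\rangle\}$; for $A,C\subseteq X$, $[A,C]=\{x\in X: \exists a\in A,\,c\in C,\ \langle a,x,c\rangle\}$. *)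

theory Defs
  imports Main
begin

text \<open>The ternary relation is a predicate on the ambient type; only its restriction to the
  carrier \<open>X\<close> is ever used.\<close>

locale interval_space =
  fixes X :: "'a set" and R :: "'a \<Rightarrow> 'a \<Rightarrow> 'a \<Rightarrow> bool"
  assumes left_refl: "x \<in> X \<Longrightarrow> a \<in> X \<Longrightarrow> R x x a"
    and right_refl: "x \<in> X \<Longrightarrow> a \<in> X \<Longrightarrow> R a x x"
    and symmetric: "x \<in> X \<Longrightarrow> a \<in> X \<Longrightarrow> z \<in> X \<Longrightarrow> R x a z \<Longrightarrow> R z a x"
    and degenerate: "x \<in> X \<Longrightarrow> y \<in> X \<Longrightarrow> R x y x \<Longrightarrow> y = x"

definition set_rel :: "('a \<Rightarrow> 'a \<Rightarrow> 'a \<Rightarrow> bool) \<Rightarrow> 'a set \<Rightarrow> 'a \<Rightarrow> 'a \<Rightarrow> bool" where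
  "set_rel R A b c \<longleftrightarrow> (\<exists>a\<in>A. R a b c)"

definition interval :: "'a set \<Rightarrow> ('a \<Rightarrow> 'a \<Rightarrow> 'a \<Rightarrow> bool) \<Rightarrow> 'a \<Rightarrow> 'a \<Rightarrow> 'a set" where
  "interval X R a c = {x \<in> X. R a x c}"

definition set_interval :: "'a set \<Rightarrow> ('a \<Rightarrow> 'a \<Rightarrow> 'a \<Rightarrow> bool) \<Rightarrow> 'a set \<Rightarrow> 'a set \<Rightarrow> 'a set" where
  "set_interval X R A C = {x \<in> X. \<exists>a\<in>A. \<exists>c\<in>C. R a x c}"

end

(* Transitivity of <A,_,_> says that [A,_] absorbs a repetition of itself: [A,[A,C]] is contained
   in [A,C].  Since A = [a,b] contains both endpoints, monotonicity gives
   [a,[b,c]] \<subseteq> [A,[A,c]] \<subseteq> [A,c]. *)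

theory Submission
  imports Defs
begin

lemma interval_eq_set_interval: "interval X R a c = set_interval X R {a} {c}"
  by (simp add: interval_def set_interval_def)

lemma set_interval_eq_set_rel: "set_interval X R A C = {x \<in> X. \<exists>c\<in>C. set_rel R A x c}"
  by (auto simp: set_interval_def set_rel_def)

lemma set_interval_mono:
  assumes "A \<subseteq> B" and "C \<subseteq> D"
  shows "set_interval X R A C \<subseteq> set_interval X R B D"
  using assms by (fastforce simp: set_interval_def)

lemma set_interval_absorb:
  assumes trans: "transp_on X (set_rel R A)" and "C \<subseteq> X"
  shows "set_interval X R A (set_interval X R A C) \<subseteq> set_interval X R A C"
proof
  fix x
  assume "x \<in> set_interval X R A (set_interval X R A C)"
  then obtain y c where "x \<in> X" "y \<in> X" "c \<in> C" "set_rel R A x y" "set_rel R A y c"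
    by (auto simp: set_interval_eq_set_rel)
  moreover from this have "set_rel R A x c"
    using trans \<open>C \<subseteq> X\<close> by (blast dest: transp_onD)
  ultimately show "x \<in> set_interval X R A C"
    by (auto simp: set_interval_eq_set_rel)
qed

lemma (in interval_space) endpoints_subset_interval:
  assumes "a \<in> X" and "b \<in> X"
  shows "{a, b} \<subseteq> interval X R a b"
  using assms by (simp add: interval_def left_refl right_refl)

theorem proposition2p2:
  fixes X :: "'a set" and R :: "'a \<Rightarrow> 'a \<Rightarrow> 'a \<Rightarrow> bool" and a b :: 'a
  assumes "interval_space X R"
    and "a \<in> X" and "b \<in> X"
    and "transp_on X (set_rel R (interval X R a b))"
  shows "\<forall>c\<in>X. set_interval X R {a} (interval X R b c)
                 \<subseteq> set_interval X R (interval X R a b) {c}"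
proof
  fix c
  assume "c \<in> X"
  let ?A = "interval X R a b"
  have endpoints: "{a} \<subseteq> ?A" "{b} \<subseteq> ?A"
    using interval_space.endpoints_subset_interval[OF assms(1-3)] by simp_all
  have "set_interval X R {a} (interval X R b c) = set_interval X R {a} (set_interval X R {b} {c})"
    by (simp only: interval_eq_set_interval)
  also have "\<dots> \<subseteq> set_interval X R ?A (set_interval X R ?A {c})"
    by (intro set_interval_mono endpoints order_refl)
  also have "\<dots> \<subseteq> set_interval X R ?A {c}"
    using assms(4) \<open>c \<in> X\<close> by (simp add: set_interval_absorb)
  finally show "set_interval X R {a} (interval X R b c) \<subseteq> set_interval X R ?A {c}" .
qed

end
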